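(* Let \(G\) be a graph with biconnected components \(C_1,\dots,C_\ell\). Then \[\max_{i\in[\ell]}\operatorname{tww}(C_i)\leq \operatorname{tww}(G)\leq \max_{i\in[\ell]}\operatorname{tww}(C_i)+2.\]
   Context: All graphs are finite, simple and loopless. A cut vertex of \(G\) is a vertex whose removal increases the number of connected components; a biconnected component of \(G\) is a maximal connected subgraph of \(G\) that has no cut vertex (of itself). A trigraph is a graph whose edge set is partitioned into black and red edges; a graph is a trigraph with no red edges. For distinct vertices \(x,y\) of a trigraph, the contraction \(G/xy\) replaces \(x,y\) by a new vertex \(z\), keeps all edges not incident to \(x,y\), joins \(z\) by a black edge to every common black neighbour of \(x\) and \(y\), and by a red edge to every other vertex adjacent to \(x\) or \(y\). A contraction sequence is a sequence of such contractions starting at \(G\) and ending in a single vertex; its width is the maximum red degree occurring in any intermediate trigraph; \(\operatorname{tww}(G)\) is the minimum width of a contraction sequence. *)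

theory Defs imports Main begin

record 'a trigraph =
  verts :: "'a set"
  black_edges :: "'a set set"
  red_edges :: "'a set set"

definition all_edges :: "'a trigraph \<Rightarrow> 'a set set" where
  "all_edges G = black_edges G \<union> red_edges G"

definition wf_trigraph :: "'a trigraph \<Rightarrow> bool" where
  "wf_trigraph G \<longleftrightarrow>
     finite (verts G) \<and>
     (\<forall>e \<in> all_edges G. \<exists>u v. u \<in> verts G \<and> v \<in> verts G \<and> u \<noteq> v \<and> e = {u, v}) \<and>
     black_edges G \<inter> red_edges G = {}"

definition simple_graph :: "'a trigraph \<Rightarrow> bool" where
  "simple_graph G \<longleftrightarrow> wf_trigraph G \<and> red_edges G = {}"

definition subgraph :: "'a trigraph \<Rightarrow> 'a trigraph \<Rightarrow> bool" where
  "subgraph H G \<longleftrightarrow> simple_graph H \<and> simple_graph G \<and>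
     verts H \<subseteq> verts G \<and> black_edges H \<subseteq> black_edges G"

definition reachable :: "'a trigraph \<Rightarrow> ('a \<times> 'a) set" where
  "reachable G = {(u, v). u \<in> verts G \<and> v \<in> verts G \<and> (u, v) \<in> {(a, b). {a, b} \<in> all_edges G}\<^sup>*}"

definition connected_components :: "'a trigraph \<Rightarrow> 'a set set" where
  "connected_components G = verts G // reachable G"

definition connected_graph :: "'a trigraph \<Rightarrow> bool" where
  "connected_graph G \<longleftrightarrow> card (connected_components G) = 1"

definition delete_vertex :: "'a trigraph \<Rightarrow> 'a \<Rightarrow> 'a trigraph" where
  "delete_vertex G v =
     \<lparr> verts = verts G - {v},
       black_edges = {e \<in> black_edges G. v \<notin> e},
       red_edges = {e \<in> red_edges G. v \<notin> e} \<rparr>"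

definition cut_vertex :: "'a trigraph \<Rightarrow> 'a \<Rightarrow> bool" where
  "cut_vertex G v \<longleftrightarrow> v \<in> verts G \<and>
     card (connected_components (delete_vertex G v)) > card (connected_components G)"

text \<open>A connected graph without cut vertex may be a single vertex or a single edge, so isolated
  vertices and bridges are biconnected components as well.\<close>

definition biconnected :: "'a trigraph \<Rightarrow> bool" where
  "biconnected G \<longleftrightarrow> connected_graph G \<and> (\<nexists>v. cut_vertex G v)"

definition biconnected_components :: "'a trigraph \<Rightarrow> 'a trigraph set" where
  "biconnected_components G =
     {C. subgraph C G \<and> biconnected C \<and>
         (\<forall>H. subgraph H G \<and> biconnected H \<and> subgraph C H \<longrightarrow> H = C)}"

definition contract :: "'a trigraph \<Rightarrow> 'a \<Rightarrow> 'a \<Rightarrow> 'a \<Rightarrow> 'a trigraph" where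
  "contract G x y z =
     \<lparr> verts = insert z (verts G - {x, y}),
       black_edges = {e \<in> black_edges G. x \<notin> e \<and> y \<notin> e} \<union>
         {{z, w} | w. w \<in> verts G - {x, y} \<and>
            {x, w} \<in> black_edges G \<and> {y, w} \<in> black_edges G},
       red_edges = {e \<in> red_edges G. x \<notin> e \<and> y \<notin> e} \<union>
         {{z, w} | w. w \<in> verts G - {x, y} \<and>
            ({x, w} \<in> all_edges G \<or> {y, w} \<in> all_edges G) \<and>
            \<not> ({x, w} \<in> black_edges G \<and> {y, w} \<in> black_edges G)} \<rparr>"

text \<open>The new vertex \<open>z\<close> may be any element that differs from all remaining vertices. It may be
  \<open>x\<close> or \<open>y\<close> itself, since a finite vertex type need not contain any further element; the choice
  of \<open>z\<close> only affects the result up to isomorphism.\<close>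

definition contraction :: "'a trigraph \<Rightarrow> 'a trigraph \<Rightarrow> bool" where
  "contraction G H \<longleftrightarrow>
     (\<exists>x y z. x \<in> verts G \<and> y \<in> verts G \<and> x \<noteq> y \<and> z \<notin> verts G - {x, y} \<and> H = contract G x y z)"

definition contraction_sequence :: "'a trigraph \<Rightarrow> 'a trigraph list \<Rightarrow> bool" where
  "contraction_sequence G Gs \<longleftrightarrow>
     Gs \<noteq> [] \<and> hd Gs = G \<and>
     (\<forall>i. Suc i < length Gs \<longrightarrow> contraction (Gs ! i) (Gs ! Suc i)) \<and>
     card (verts (last Gs)) = 1"

definition red_degree :: "'a trigraph \<Rightarrow> 'a \<Rightarrow> nat" where
  "red_degree G v = card {w. {v, w} \<in> red_edges G}"

definition max_red_degree :: "'a trigraph \<Rightarrow> nat" where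
  "max_red_degree G = Max (red_degree G ` verts G)"

definition width :: "'a trigraph list \<Rightarrow> nat" where
  "width Gs = Max (max_red_degree ` set Gs)"

text \<open>Only meaningful for trigraphs with at least one vertex, as the empty trigraph has no
  contraction sequence.\<close>

definition tww :: "'a trigraph \<Rightarrow> nat" where
  "tww G = (LEAST k. \<exists>Gs. contraction_sequence G Gs \<and> width Gs = k)"

end

theory Submission imports Defs begin

text \<open>A trigraph arising from a graph by contractions is determined by the partition of the vertex
  set into the classes of contracted vertices: two classes are joined by a red edge iff both an edge
  and a non-edge run between them. Restricting the partitions to an induced subgraph, such as a
  biconnected component, does not increase red degrees; this is the lower bound.

  For the upper bound, the graph is consumed piece by piece. At each stage an induced subgraph of
  uncontracted vertices is left, and everything contracted so far forms pendant classes, at most one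
  at each remaining vertex. If at least two vertices remain, a minimal subset with at least two
  vertices that is attached to the rest through a single vertex r is either a pair or has neither a
  cut vertex nor a second component, so it lies in a biconnected component and has a contraction
  sequence of width k. This sequence is imitated with r kept apart and pendant classes merged along,
  after which the piece is merged into the pendant class of r. Keeping r apart and the pendant
  classes cost one unit of red degree each.\<close>

section \<open>Partitions as labellings, and their contraction\<close>

definition mixed :: "('a \<Rightarrow> 'a \<Rightarrow> bool) \<Rightarrow> 'a set \<Rightarrow> ('a \<Rightarrow> 'l) \<Rightarrow> 'l \<Rightarrow> 'l \<Rightarrow> bool" where
  "mixed E V f l m \<longleftrightarrow> l \<noteq> m \<and>
     (\<exists>u\<in>V. \<exists>w\<in>V. f u = l \<and> f w = m \<and> E u w) \<and>
     (\<exists>u\<in>V. \<exists>w\<in>V. f u = l \<and> f w = m \<and> \<not> E u w)"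

text \<open>Partitions are represented by labellings, and merging two parts by a change of label. Steps that
  do not change the partition are allowed, so that a step need not check that both labels occur.\<close>

inductive contractible :: "('a \<Rightarrow> 'a \<Rightarrow> bool) \<Rightarrow> 'a set \<Rightarrow> nat \<Rightarrow> ('a \<Rightarrow> 'l) \<Rightarrow> bool"
  for E V k where
  const: "\<forall>u\<in>V. \<forall>v\<in>V. f u = f v \<Longrightarrow> contractible E V k f"
| merge: "\<forall>l. card {m. mixed E V f l m} \<le> k \<Longrightarrow> contractible E V k (id(a := b) \<circ> f)
           \<Longrightarrow> contractible E V k f"

lemma mixedI:
  assumes "u \<in> V" "w \<in> V" "E u w" "u' \<in> V" "w' \<in> V" "\<not> E u' w'"
    and "f u = l" "f u' = l" "f w = m" "f w' = m" "l \<noteq> m"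
  shows "mixed E V f l m"
  using assms by (auto simp: mixed_def)

lemma mixedE:
  assumes "mixed E V f l m"
  obtains u w u' w' where "u \<in> V" "w \<in> V" "f u = l" "f w = m" "E u w"
    "u' \<in> V" "w' \<in> V" "f u' = l" "f w' = m" "\<not> E u' w'" "l \<noteq> m"
  using assms unfolding mixed_def by (elim conjE bexE) (rule that)

lemma mixed_subset_image: "{m. mixed E V f l m} \<subseteq> f ` V"
  by (auto simp: mixed_def)

lemma finite_mixed: "finite V \<Longrightarrow> finite {m. mixed E V f l m}"
  by (rule finite_subset[OF mixed_subset_image]) simp

lemma contractible_step:
  assumes "\<And>l. card {m. mixed E V f l m} \<le> k" "contractible E V k (id(a := b) \<circ> f)"
  shows "contractible E V k f"
  by (rule contractible.merge[OF allI[OF assms(1)] assms(2)])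

text \<open>Labellings with the same kernel differ by a bijection between the labels in use, which
  carries mixed pairs to mixed pairs. A label not in use has no mixed partner.\<close>

lemma card_mixed_same_kernel:
  assumes "finite V" "\<forall>l. card {m. mixed E V f l m} \<le> k"
    and kernel: "\<And>u v. u \<in> V \<Longrightarrow> v \<in> V \<Longrightarrow> f u = f v \<longleftrightarrow> g u = g v"
  shows "card {m. mixed E V g l m} \<le> k"
proof (cases "l \<in> g ` V")
  case True
  \<comment> \<open>Translates labels of \<open>f\<close> into labels of \<open>g\<close> through a
    representative of the class.\<close>
  define h where "h = g \<circ> inv_into V f"
  have h: "h (f x) = g x" if "x \<in> V" for x
  proof -
    have "inv_into V f (f x) \<in> V" "f (inv_into V f (f x)) = f x"
      by (rule inv_into_into[OF imageI[OF that]], rule f_inv_into_f[OF imageI[OF that]])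
    then show ?thesis using kernel[of "inv_into V f (f x)" x] that by (simp add: h_def)
  qed
  from True obtain x where x: "x \<in> V" "l = g x" by blast
  have "{m. mixed E V g l m} \<subseteq> h ` {m. mixed E V f (f x) m}"
  proof
    fix m assume m: "m \<in> {m. mixed E V g l m}"
    then obtain y where y: "y \<in> V" "m = g y" by (auto simp: mixed_def)
    obtain u w u' w' where "u \<in> V" "w \<in> V" "g u = g x" "g w = g y" "E u w"
      "u' \<in> V" "w' \<in> V" "g u' = g x" "g w' = g y" "\<not> E u' w'" "g x \<noteq> g y"
      using m unfolding mem_Collect_eq x(2) y(2) by (rule mixedE)
    then have "mixed E V f (f x) (f y)"
      using kernel[of u x] kernel[of w y] kernel[of u' x] kernel[of w' y] kernel[of x y] x y
      by (intro mixedI[of u V w E u' w']) simp_all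
    then show "m \<in> h ` {m. mixed E V f (f x) m}" using h[OF y(1)] y(2) by force
  qed
  then show ?thesis
    by (rule order_trans[OF surj_card_le[OF finite_mixed[OF assms(1)]] spec[OF assms(2)]])
next
  case False
  then have "{m. mixed E V g l m} = {}" by (auto simp: mixed_def)
  then show ?thesis by simp
qed

text \<open>Besides passing to another labelling, possibly with labels of another type, this
  normalises the steps: vacuous ones are dropped, so each remaining merge joins two distinct labels
  in use and is a genuine contraction.\<close>

lemma contractible_same_kernel_induct:
  assumes "contractible E V k f" "finite V"
    and "\<forall>u\<in>V. \<forall>v\<in>V. f u = f v \<longleftrightarrow> g u = g v"
    and const: "\<And>g. (\<And>u v. u \<in> V \<Longrightarrow> v \<in> V \<Longrightarrow> g u = g v) \<Longrightarrow> P g"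
    and merge: "\<And>g a b. a \<in> g ` V \<Longrightarrow> b \<in> g ` V \<Longrightarrow> a \<noteq> b \<Longrightarrow>
      (\<And>l. card {m. mixed E V g l m} \<le> k) \<Longrightarrow> P (id(a := b) \<circ> g) \<Longrightarrow> P g"
  shows "P g"
  using assms(1,3)
proof (induction arbitrary: g)
  case (const f)
  then have "g u = g v" if "u \<in> V" "v \<in> V" for u v using that by blast
  then show ?case by (rule assms(4))
next
  case (merge f a b)
  have kernel: "f u = f v \<longleftrightarrow> g u = g v" if "u \<in> V" "v \<in> V" for u v
    using merge.prems that by blast
  show ?case
  proof (cases "a \<noteq> b \<and> (\<exists>u\<in>V. \<exists>w\<in>V. f u = a \<and> f w = b)")
    case True
    then obtain u w where uw: "u \<in> V" "w \<in> V" "f u = a" "f w = b" "a \<noteq> b" by blast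
    have "P (id(g u := g w) \<circ> g)"
      using kernel uw by (intro merge.IH) auto
    moreover have "g u \<noteq> g w" using kernel uw by blast
    moreover have "card {m. mixed E V g l m} \<le> k" for l
      by (rule card_mixed_same_kernel[OF assms(2) merge.hyps(1) kernel])
    ultimately show ?thesis using uw(1,2) by (intro assms(5)[of "g u" g "g w"]) blast+
  next
    \<comment> \<open>The merge leaves the partition unchanged, so the induction hypothesis already
      applies to \<open>g\<close>.\<close>
    case False
    then have "\<forall>u\<in>V. \<forall>v\<in>V. (id(a := b) \<circ> f) u = (id(a := b) \<circ> f) v \<longleftrightarrow> f u = f v" by auto
    then show ?thesis using kernel by (intro merge.IH ballI) auto
  qed
qed

lemma contractible_same_kernel:
  assumes "contractible E V k f" "finite V"
    and "\<And>u v. u \<in> V \<Longrightarrow> v \<in> V \<Longrightarrow> f u = f v \<longleftrightarrow> g u = g v"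
  shows "contractible E V k (g :: 'a \<Rightarrow> 'b)"
proof (rule contractible_same_kernel_induct[where P = "contractible E V k", OF assms(1,2)])
  show "contractible E V k g" if "\<And>u v. u \<in> V \<Longrightarrow> v \<in> V \<Longrightarrow> g u = g v" for g :: "'a \<Rightarrow> 'b"
    using that by (intro contractible.const ballI)
qed (use assms(3) in blast, rule contractible_step)

text \<open>The same merges work on \<open>W\<close>: fewer vertices give fewer witnesses of
  mixedness. Applied to the vertices of a biconnected component, this is the lower bound.\<close>

lemma contractible_subset:
  assumes "contractible E V k f" "finite V" "W \<subseteq> V"
  shows "contractible E W k f"
  using assms(1)
proof induction
  case (const f)
  then show ?case by (meson contractible.const subsetD assms(3))
next
  case (merge f a b)
  have "card {m. mixed E W f l m} \<le> k" for l
  proof -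
    have "{m. mixed E W f l m} \<subseteq> {m. mixed E V f l m}"
      using assms(3) unfolding mixed_def by blast
    then show ?thesis
      by (rule order_trans[OF card_mono[OF finite_mixed[OF assms(2)]] spec[OF merge.hyps(1)]])
  qed
  then show ?case using merge.IH by (rule contractible_step)
qed

lemma contractible_cong_edges:
  assumes "contractible E V k f" "\<forall>u\<in>V. \<forall>w\<in>V. E u w \<longleftrightarrow> E' u w"
  shows "contractible E' V k f"
  using assms(1)
proof induction
  case (const f)
  then show ?case by (rule contractible.const)
next
  case (merge f a b)
  have "mixed E' V f = mixed E V f"
    using assms(2) by (intro ext) (auto simp: mixed_def)
  then have "card {m. mixed E' V f l m} \<le> k" for l
    using merge.hyps(1) by simp
  then show ?case using merge.IH by (rule contractible_step)
qed

text \<open>Labels in use may be merged in any order, since no class has more mixed partners than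
  there are vertices. This provides a contraction sequence of every nonempty graph, so that the
  minimum in \<open>tww\<close> is attained.\<close>

lemma contractible_card:
  assumes "finite V"
  shows "contractible E V (card V) f"
proof (induction "card (f ` V)" arbitrary: f rule: less_induct)
  case less
  show ?case
  proof (cases "\<forall>u\<in>V. \<forall>v\<in>V. f u = f v")
    case True
    then show ?thesis by (rule contractible.const)
  next
    case False
    then obtain u v where uv: "u \<in> V" "v \<in> V" "f u \<noteq> f v" by blast
    have "(id(f u := f v) \<circ> f) ` V \<subset> f ` V" using uv by (auto simp: image_iff)
    then have "contractible E V (card V) (id(f u := f v) \<circ> f)"
      using assms by (intro less psubset_card_mono) auto
    moreover have "card {m. mixed E V f l m} \<le> card V" for l
      using surj_card_le[OF assms mixed_subset_image] .
    ultimately show ?thesis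
      by (metis contractible_step)
  qed
qed

subsection \<open>Trigraphs of labellings\<close>

definition edge_rel :: "'a trigraph \<Rightarrow> 'a \<Rightarrow> 'a \<Rightarrow> bool" where
  "edge_rel G u w \<longleftrightarrow> {u, w} \<in> black_edges G"

text \<open>Black adjacency in the quotient. Both labels must be in use because the universal
  condition holds vacuously for empty classes.\<close>

definition joined :: "('a \<Rightarrow> 'a \<Rightarrow> bool) \<Rightarrow> 'a set \<Rightarrow> ('a \<Rightarrow> 'l) \<Rightarrow> 'l \<Rightarrow> 'l \<Rightarrow> bool" where
  "joined E V f l m \<longleftrightarrow> l \<in> f ` V \<and> m \<in> f ` V \<and> l \<noteq> m \<and>
     (\<forall>u\<in>V. \<forall>w\<in>V. f u = l \<longrightarrow> f w = m \<longrightarrow> E u w)"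

definition quotient_trigraph :: "('a \<Rightarrow> 'a \<Rightarrow> bool) \<Rightarrow> 'a set \<Rightarrow> ('a \<Rightarrow> 'l) \<Rightarrow> 'l trigraph" where
  "quotient_trigraph E V f =
     \<lparr> verts = f ` V,
       black_edges = {{l, m} | l m. joined E V f l m},
       red_edges = {{l, m} | l m. mixed E V f l m} \<rparr>"

lemma mixed_commute: "symp E \<Longrightarrow> mixed E V f l m \<longleftrightarrow> mixed E V f m l"
  unfolding mixed_def symp_def by blast

lemma joined_commute: "symp E \<Longrightarrow> joined E V f l m \<longleftrightarrow> joined E V f m l"
  unfolding joined_def symp_def by blast

lemma pair_in_Collect_pairs:
  assumes "\<And>l m. R l m \<longleftrightarrow> R m l"
  shows "{l, m} \<in> {{l, m} | l m. R l m} \<longleftrightarrow> R l m"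
proof -
  have "R l m" if "{l, m} = {l', m'}" "R l' m'" for l' m'
    using that assms[of l m] by (auto simp: doubleton_eq_iff)
  then show ?thesis by blast
qed

lemma
  assumes "symp E"
  shows black_quotient: "{l, m} \<in> black_edges (quotient_trigraph E V f) \<longleftrightarrow> joined E V f l m"
    and red_quotient: "{l, m} \<in> red_edges (quotient_trigraph E V f) \<longleftrightarrow> mixed E V f l m"
  unfolding quotient_trigraph_def trigraph.select_convs
  by (rule pair_in_Collect_pairs, rule joined_commute[OF assms])
    (rule pair_in_Collect_pairs, rule mixed_commute[OF assms])

lemma Collect_pairs_eqI:
  assumes "\<And>e. e \<in> A \<Longrightarrow> \<exists>l m. e = {l, m}" "\<And>e. e \<in> B \<Longrightarrow> \<exists>l m. e = {l, m}"
    and "\<And>l m. {l, m} \<in> A \<longleftrightarrow> {l, m} \<in> B"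
  shows "A = B"
proof (intro set_eqI)
  fix e
  show "e \<in> A \<longleftrightarrow> e \<in> B"
  proof (cases "\<exists>l m. e = {l, m}")
    case True
    then show ?thesis using assms(3) by auto
  next
    case False
    then show ?thesis using assms(1)[of e] assms(2)[of e] by blast
  qed
qed

text \<open>Singleton classes are never mixed. Contraction sequences of \<open>G\<close> thus start
  at the identity labelling.\<close>

lemma quotient_trigraph_id:
  assumes "simple_graph G"
  shows "quotient_trigraph (edge_rel G) (verts G) id = G"
proof -
  have e: "\<exists>u v. u \<in> verts G \<and> v \<in> verts G \<and> u \<noteq> v \<and> e = {u, v}" if "e \<in> black_edges G" for e
    using that assms by (auto simp: simple_graph_def wf_trigraph_def all_edges_def)
  have "black_edges (quotient_trigraph (edge_rel G) (verts G) id) = black_edges G"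
    unfolding quotient_trigraph_def joined_def edge_rel_def
    using e by auto blast
  moreover have "red_edges (quotient_trigraph (edge_rel G) (verts G) id) = red_edges G"
    using assms unfolding quotient_trigraph_def mixed_def by (auto simp: simple_graph_def)
  moreover have "verts (quotient_trigraph (edge_rel G) (verts G) id) = verts G"
    by (simp add: quotient_trigraph_def)
  ultimately show ?thesis by (cases G) (simp add: quotient_trigraph_def)
qed

lemma symp_edge_rel: "symp (edge_rel G)"
  by (simp add: edge_rel_def symp_def insert_commute)

lemma joined_or_mixed:
  "joined E V f l m \<or> mixed E V f l m \<longleftrightarrow> l \<noteq> m \<and> (\<exists>u\<in>V. \<exists>w\<in>V. f u = l \<and> f w = m \<and> E u w)"
    (is "_ \<longleftrightarrow> ?adj")
proof
  assume "joined E V f l m \<or> mixed E V f l m"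
  then show ?adj
  proof
    assume j: "joined E V f l m"
    then obtain u w where "u \<in> V" "w \<in> V" "f u = l" "f w = m"
      by (auto simp: joined_def)
    then show ?adj using j by (auto simp: joined_def)
  qed (simp add: mixed_def)
next
  assume adj: ?adj
  then have "l \<in> f ` V" "m \<in> f ` V" by blast+
  then show "joined E V f l m \<or> mixed E V f l m"
    using adj by (auto simp: joined_def mixed_def)
qed

text \<open>The merged class is completely joined to another class iff both of its halves are, and
  has an edge to it iff one of them has. These are the rules by which \<open>contract\<close>
  colours the edges at the new vertex.\<close>

lemma contract_quotient:
  assumes "symp E" "x \<in> f ` V" "y \<in> f ` V" "x \<noteq> y" "z \<notin> f ` V - {x, y}"
  shows "contract (quotient_trigraph E V f) x y z =
    quotient_trigraph E V (\<lambda>v. if f v = x \<or> f v = y then z else f v)"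
    (is "contract ?Q x y z = _")
proof -
  define g where "g = (\<lambda>v. if f v = x \<or> f v = y then z else f v)"
  have vert: "verts ?Q = f ` V" by (simp add: quotient_trigraph_def)
  have gV: "g ` V = insert z (f ` V - {x, y})" using assms(2) by (auto simp: g_def)
  \<comment> \<open>Since \<open>z\<close> is no other label in use, the classes apart from
    \<open>x\<close> and \<open>y\<close> keep their vertices; \<open>z\<close> itself may be
    \<open>x\<close> or \<open>y\<close>.\<close>
  have old: "g v = l \<longleftrightarrow> f v = l" if "l \<in> f ` V - {x, y}" "v \<in> V" for l v
    using that assms(5) by (auto simp: g_def)
  have new: "g v = z \<longleftrightarrow> f v = x \<or> f v = y" if "v \<in> V" for v
    using that assms(5) by (auto simp: g_def)
  have joined_old: "joined E V g l m \<longleftrightarrow> joined E V f l m"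
    if "l \<in> f ` V - {x, y}" "m \<in> f ` V - {x, y}" for l m
    unfolding joined_def gV using that old by simp
  have mixed_old: "mixed E V g l m \<longleftrightarrow> mixed E V f l m"
    if "l \<in> f ` V - {x, y}" "m \<in> f ` V - {x, y}" for l m
    unfolding mixed_def using that old by simp
  have joined_new: "joined E V g z m \<longleftrightarrow> joined E V f x m \<and> joined E V f y m"
    if m: "m \<in> f ` V - {x, y}" for m
  proof -
    have "m \<noteq> z" using m assms(5) by blast
    then show ?thesis
      unfolding joined_def gV using m old[OF m] new assms(2,3) by simp blast
  qed
  have mixed_new: "mixed E V g z m \<longleftrightarrow>
      (joined E V f x m \<or> mixed E V f x m \<or> joined E V f y m \<or> mixed E V f y m) \<and>
      \<not> (joined E V f x m \<and> joined E V f y m)"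
    if m: "m \<in> f ` V - {x, y}" for m
  proof -
    have mz: "m \<noteq> z" using m assms(5) by blast
    \<comment> \<open>Red is adjacency minus black, as the two colours exclude each other.\<close>
    have "joined E V g z m \<or> mixed E V g z m \<longleftrightarrow>
        (\<exists>u\<in>V. \<exists>w\<in>V. (f u = x \<or> f u = y) \<and> f w = m \<and> E u w)"
      unfolding joined_or_mixed using mz old[OF m] new by simp
    also have "\<dots> \<longleftrightarrow> (joined E V f x m \<or> mixed E V f x m) \<or> (joined E V f y m \<or> mixed E V f y m)"
      unfolding joined_or_mixed using m by blast
    finally have "joined E V g z m \<or> mixed E V g z m \<longleftrightarrow> \<dots>" .
    moreover have "\<not> (joined E V g z m \<and> mixed E V g z m)"
      by (auto simp: joined_def mixed_def)
    ultimately show ?thesis using joined_new[OF m] by blast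
  qed
  have labels: "l \<in> insert z (f ` V - {x, y}) \<and> m \<in> insert z (f ` V - {x, y}) \<and> l \<noteq> m"
    if "joined E V g l m \<or> mixed E V g l m" for l m
    using that unfolding gV[symmetric] joined_def mixed_def by blast
  have labels_f: "l \<in> f ` V \<and> m \<in> f ` V"
    if "joined E V f l m \<or> mixed E V f l m" for l m
    using that unfolding joined_def mixed_def by blast
  have black: "{{l, m} | l m. joined E V g l m} = black_edges (contract ?Q x y z)" (is "?A = ?B")
  proof (rule Collect_pairs_eqI)
    fix l m
    have "{l, m} \<in> ?B \<longleftrightarrow>
       joined E V f l m \<and> l \<notin> {x, y} \<and> m \<notin> {x, y} \<or>
       l = z \<and> m \<in> f ` V - {x, y} \<and> joined E V f x m \<and> joined E V f y m \<or>
       m = z \<and> l \<in> f ` V - {x, y} \<and> joined E V f x l \<and> joined E V f y l"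
      unfolding contract_def vert
      by (simp add: black_quotient[OF assms(1)] doubleton_eq_iff) blast
    also have "\<dots> \<longleftrightarrow> joined E V g l m"
    proof -
      have z: "z \<notin> f ` V - {x, y}" by (rule assms(5))
      \<comment> \<open>Both labels are old, or one is new and the other old; any other pair is an
        edge on neither side.\<close>
      consider "l \<in> f ` V - {x, y}" "m \<in> f ` V - {x, y}"
        | "l = z" "m \<in> f ` V - {x, y}" | "m = z" "l \<in> f ` V - {x, y}"
        | "\<not> (l \<in> f ` V - {x, y} \<and> m \<in> f ` V - {x, y})"
          "\<not> (l = z \<and> m \<in> f ` V - {x, y})" "\<not> (m = z \<and> l \<in> f ` V - {x, y})"
        by blast
      then show ?thesis
      proof cases
        case 1
        moreover have "l \<noteq> z" "m \<noteq> z" using 1 z by blast+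
        ultimately show ?thesis using joined_old[OF 1] by simp
      next
        case 2
        moreover have "m \<noteq> z" using 2 z by blast
        moreover have "\<not> (joined E V f z m \<and> z \<notin> {x, y})" using z labels_f[of z m] by blast
        ultimately show ?thesis using joined_new[OF 2(2)] by auto
      next
        case 3
        moreover have "l \<noteq> z" using 3 z by blast
        moreover have "\<not> (joined E V f l z \<and> z \<notin> {x, y})" using z labels_f[of l z] by blast
        ultimately show ?thesis
          using joined_new[OF 3(2)] joined_commute[OF assms(1), of V g l z] by auto
      next
        case 4
        then have "\<not> joined E V g l m" using labels[of l m] by blast
        moreover have "\<not> (joined E V f l m \<and> l \<notin> {x, y} \<and> m \<notin> {x, y})"
          using 4(1) labels_f[of l m] by blast
        ultimately show ?thesis using 4(2,3) by blast
      qed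
    qed
    finally show "{l, m} \<in> ?A \<longleftrightarrow> {l, m} \<in> ?B"
      using pair_in_Collect_pairs[of "joined E V g", OF joined_commute[OF assms(1)]] by simp
  qed (auto simp: contract_def quotient_trigraph_def)
  have red: "{{l, m} | l m. mixed E V g l m} = red_edges (contract ?Q x y z)" (is "?A = ?B")
  proof (rule Collect_pairs_eqI)
    fix l m
    have "{l, m} \<in> ?B \<longleftrightarrow>
       mixed E V f l m \<and> l \<notin> {x, y} \<and> m \<notin> {x, y} \<or>
       l = z \<and> m \<in> f ` V - {x, y} \<and>
         (joined E V f x m \<or> mixed E V f x m \<or> joined E V f y m \<or> mixed E V f y m) \<and>
         \<not> (joined E V f x m \<and> joined E V f y m) \<or>
       m = z \<and> l \<in> f ` V - {x, y} \<and>
         (joined E V f x l \<or> mixed E V f x l \<or> joined E V f y l \<or> mixed E V f y l) \<and>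
         \<not> (joined E V f x l \<and> joined E V f y l)"
      unfolding contract_def vert all_edges_def
      by (simp add: black_quotient[OF assms(1)] red_quotient[OF assms(1)] doubleton_eq_iff) blast
    also have "\<dots> \<longleftrightarrow> mixed E V g l m"
    proof -
      have z: "z \<notin> f ` V - {x, y}" by (rule assms(5))
      consider "l \<in> f ` V - {x, y}" "m \<in> f ` V - {x, y}"
        | "l = z" "m \<in> f ` V - {x, y}" | "m = z" "l \<in> f ` V - {x, y}"
        | "\<not> (l \<in> f ` V - {x, y} \<and> m \<in> f ` V - {x, y})"
          "\<not> (l = z \<and> m \<in> f ` V - {x, y})" "\<not> (m = z \<and> l \<in> f ` V - {x, y})"
        by blast
      then show ?thesis
      proof cases
        case 1
        moreover have "l \<noteq> z" "m \<noteq> z" using 1 z by blast+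
        ultimately show ?thesis using mixed_old[OF 1] by simp
      next
        case 2
        moreover have "m \<noteq> z" using 2 z by blast
        moreover have "\<not> (mixed E V f z m \<and> z \<notin> {x, y})" using z labels_f[of z m] by blast
        ultimately show ?thesis using mixed_new[OF 2(2)] by auto
      next
        case 3
        moreover have "l \<noteq> z" using 3 z by blast
        moreover have "\<not> (mixed E V f l z \<and> z \<notin> {x, y})" using z labels_f[of l z] by blast
        ultimately show ?thesis
          using mixed_new[OF 3(2)] mixed_commute[OF assms(1), of V g l z] by auto
      next
        case 4
        then have "\<not> mixed E V g l m" using labels[of l m] by blast
        moreover have "\<not> (mixed E V f l m \<and> l \<notin> {x, y} \<and> m \<notin> {x, y})"
          using 4(1) labels_f[of l m] by blast
        ultimately show ?thesis using 4(2,3) by blast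
      qed
    qed
    finally show "{l, m} \<in> ?A \<longleftrightarrow> {l, m} \<in> ?B"
      using pair_in_Collect_pairs[of "mixed E V g", OF mixed_commute[OF assms(1)]] by simp
  qed (auto simp: contract_def quotient_trigraph_def)
  have "verts (contract ?Q x y z) = g ` V"
    unfolding gV by (simp add: contract_def vert)
  then have "contract ?Q x y z = quotient_trigraph E V g"
    using black red by (simp add: quotient_trigraph_def[of E V g])
  then show ?thesis by (simp add: g_def)
qed

section \<open>Contraction sequences and twin-width through labellings\<close>

lemma red_degree_quotient:
  "symp E \<Longrightarrow> red_degree (quotient_trigraph E V f) l = card {m. mixed E V f l m}"
  by (simp add: red_degree_def red_quotient)

lemma max_red_degree_quotient_le:
  assumes "symp E" "finite V" "V \<noteq> {}"
  shows "max_red_degree (quotient_trigraph E V f) \<le> k \<longleftrightarrow> (\<forall>l. card {m. mixed E V f l m} \<le> k)"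
proof -
  have "card {m. mixed E V f l m} \<le> k" if "l \<notin> f ` V" for l
  proof -
    have "{m. mixed E V f l m} = {}" using that by (auto simp: mixed_def)
    then show ?thesis by simp
  qed
  then have "(\<forall>l. card {m. mixed E V f l m} \<le> k) \<longleftrightarrow> (\<forall>l\<in>f ` V. card {m. mixed E V f l m} \<le> k)"
    by blast
  moreover have "verts (quotient_trigraph E V f) = f ` V" by (simp add: quotient_trigraph_def)
  ultimately show ?thesis
    using assms by (simp add: max_red_degree_def red_degree_quotient)
qed

lemma contractible_if_sequence:
  assumes "symp E" "finite V" "V \<noteq> {}"
    and "contraction_sequence (quotient_trigraph E V f) Gs" "\<forall>T\<in>set Gs. max_red_degree T \<le> k"
  shows "contractible E V k f"
  using assms(4,5)
proof (induction Gs arbitrary: f)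
  case Nil
  then show ?case by (simp add: contraction_sequence_def)
next
  case (Cons T Gs)
  have T: "T = quotient_trigraph E V f" using Cons.prems by (simp add: contraction_sequence_def)
  show ?case
  proof (cases "Gs = []")
    case True
    then have "card (f ` V) = 1"
      using Cons.prems T by (simp add: contraction_sequence_def quotient_trigraph_def)
    then obtain l where "f ` V = {l}" by (auto simp: card_1_singleton_iff)
    then have "\<forall>u\<in>V. f u = l" by blast
    then show ?thesis by (intro contractible.const) simp
  next
    case False
    then have "contraction T (hd Gs)"
      using Cons.prems by (auto simp: contraction_sequence_def hd_conv_nth dest!: spec[of _ 0])
    then obtain x y z where xyz: "x \<in> f ` V" "y \<in> f ` V" "x \<noteq> y" "z \<notin> f ` V - {x, y}"
      and hd: "hd Gs = contract T x y z"
      by (auto simp: contraction_def T quotient_trigraph_def)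
    let ?g = "\<lambda>v. if f v = x \<or> f v = y then z else f v"
    have "contraction_sequence (hd Gs) Gs"
      using Cons.prems False by (fastforce simp: contraction_sequence_def)
    then have "contractible E V k ?g"
      using Cons.IH Cons.prems(2) contract_quotient[OF assms(1) xyz] hd T by simp
    \<comment> \<open>A contraction may introduce a new label \<open>z\<close>, whereas a merge
      reuses \<open>y\<close>; the partitions agree.\<close>
    then have "contractible E V k (id(x := y) \<circ> f)"
    proof (rule contractible_same_kernel[OF _ assms(2)])
      fix u v assume "u \<in> V" "v \<in> V"
      then have "f u \<in> f ` V" "f v \<in> f ` V" by blast+
      then show "?g u = ?g v \<longleftrightarrow> (id(x := y) \<circ> f) u = (id(x := y) \<circ> f) v"
        using xyz(3,4) by auto
    qed
    moreover have "card {m. mixed E V f l m} \<le> k" for l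
      using Cons.prems(2) T max_red_degree_quotient_le[OF assms(1-3), of f k] by simp
    ultimately show ?thesis by (blast intro: contractible_step)
  qed
qed

text \<open>The normalised induction yields only merges of distinct labels in use, and each is the
  contraction whose new vertex is the surviving label \<open>b\<close>.\<close>

lemma sequence_if_contractible:
  assumes "symp E" "finite V" "V \<noteq> {}" "contractible E V k (f :: 'a \<Rightarrow> 'b)"
  shows "\<exists>Gs. contraction_sequence (quotient_trigraph E V f) Gs \<and> (\<forall>T\<in>set Gs. max_red_degree T \<le> k)"
proof (rule contractible_same_kernel_induct[where
      P = "\<lambda>f. \<exists>Gs. contraction_sequence (quotient_trigraph E V f) Gs \<and> (\<forall>T\<in>set Gs. max_red_degree T \<le> k)",
      OF assms(4,2) ballI[OF ballI[OF refl]]])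
  fix f :: "'a \<Rightarrow> 'b"
  assume const: "\<And>u v. u \<in> V \<Longrightarrow> v \<in> V \<Longrightarrow> f u = f v"
  obtain v where v: "v \<in> V" using assms(3) by blast
  obtain c where c: "\<forall>u\<in>V. f u = c" using const[OF _ v] by blast
  then have "f ` V = {c}" using v by force
  moreover have "{m. mixed E V f l m} = {}" for l
    using c by (auto simp: mixed_def)
  ultimately show "\<exists>Gs. contraction_sequence (quotient_trigraph E V f) Gs \<and> (\<forall>T\<in>set Gs. max_red_degree T \<le> k)"
    using max_red_degree_quotient_le[OF assms(1-3), of f k]
    by (intro exI[of _ "[quotient_trigraph E V f]"])
      (simp add: contraction_sequence_def quotient_trigraph_def)
next
  fix f :: "'a \<Rightarrow> 'b" and a b
  assume labels: "a \<in> f ` V" "b \<in> f ` V" "a \<noteq> b"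
    and card: "\<And>l. card {m. mixed E V f l m} \<le> k"
    and IH: "\<exists>Gs. contraction_sequence (quotient_trigraph E V (id(a := b) \<circ> f)) Gs \<and>
      (\<forall>T\<in>set Gs. max_red_degree T \<le> k)"
  let ?Q = "quotient_trigraph E V f"
  obtain Gs where Gs: "contraction_sequence (quotient_trigraph E V (id(a := b) \<circ> f)) Gs"
    "\<forall>T\<in>set Gs. max_red_degree T \<le> k"
    using IH by blast
  have "(\<lambda>v. if f v = a \<or> f v = b then b else f v) = id(a := b) \<circ> f" by auto
  then have "quotient_trigraph E V (id(a := b) \<circ> f) = contract ?Q a b b"
    using contract_quotient[OF assms(1) labels, of b] by simp
  moreover have "contraction ?Q (contract ?Q a b b)"
    using labels unfolding contraction_def
    by (intro exI[of _ a] exI[of _ b]) (simp add: quotient_trigraph_def)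
  ultimately have "contraction_sequence ?Q (?Q # Gs)"
    using Gs(1) by (auto simp: contraction_sequence_def hd_conv_nth nth_Cons split: nat.split)
  moreover have "max_red_degree ?Q \<le> k"
    using card max_red_degree_quotient_le[OF assms(1-3)] by blast
  ultimately show "\<exists>Gs. contraction_sequence ?Q Gs \<and> (\<forall>T\<in>set Gs. max_red_degree T \<le> k)"
    using Gs(2) by (intro exI[of _ "?Q # Gs"]) simp
qed

text \<open>Sequences and merges translate into each other with the same bound on red degrees, and a
  sequence of least width exists.\<close>

lemma tww_le_iff:
  assumes "simple_graph G" "verts G \<noteq> {}"
  shows "tww G \<le> k \<longleftrightarrow> contractible (edge_rel G) (verts G) k id"
proof -
  have fin: "finite (verts G)" using assms(1) by (simp add: simple_graph_def wf_trigraph_def)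
  have width: "width Gs \<le> k \<longleftrightarrow> (\<forall>T\<in>set Gs. max_red_degree T \<le> k)"
    if "contraction_sequence G Gs" for Gs k
    using that by (simp add: width_def contraction_sequence_def)
  have seq: "contractible (edge_rel G) (verts G) k id \<longleftrightarrow>
      (\<exists>Gs. contraction_sequence G Gs \<and> width Gs \<le> k)" for k
    using sequence_if_contractible[OF symp_edge_rel fin assms(2), of G k id]
      contractible_if_sequence[OF symp_edge_rel fin assms(2), of G id _ k] width
    unfolding quotient_trigraph_id[OF assms(1)] by blast
  obtain Gs where "contraction_sequence G Gs"
    using contractible_card[OF fin] seq by blast
  then have ex: "\<exists>k Gs. contraction_sequence G Gs \<and> width Gs = k" by blast
  have "\<exists>Gs. contraction_sequence G Gs \<and> width Gs = tww G"
    unfolding tww_def by (rule LeastI_ex[OF ex])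
  moreover have "tww G \<le> width Gs" if "contraction_sequence G Gs" for Gs
    unfolding tww_def by (rule Least_le) (use that in blast)
  ultimately show ?thesis unfolding seq by (metis order_trans)
qed

subsection \<open>Absorbing a leaf piece\<close>

text \<open>In the main use \<open>Y\<close> holds the mixed partners within the piece, while
  \<open>a\<close> and \<open>b\<close> are the two additional red neighbours allowed by the
  theorem.\<close>

lemma card_le_insert2:
  assumes "X \<subseteq> insert a (insert b (f ` Y))" "finite Y" "card Y \<le> k"
  shows "card X \<le> k + 2"
proof -
  have "card X \<le> card (insert a (insert b (f ` Y)))"
    using assms by (intro card_mono) auto
  also have "\<dots> \<le> Suc (Suc (card (f ` Y)))"
    using assms(2) by (simp add: card_insert_if)
  also have "\<dots> \<le> k + 2" using card_image_le[OF assms(2), of f] assms(3) by simp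
  finally show ?thesis .
qed

lemma card_le_pair: "X \<subseteq> {a, b} \<Longrightarrow> card X \<le> k + 2"
  using card_le_insert2[of X a b id "{}" k] by simp

text \<open>Singletons are never mixed and one merge finishes. This covers nonadjacent pairs too,
  which need not lie in a common biconnected component.\<close>

lemma contractible_pair:
  assumes "symp E" "card C = 2"
  shows "contractible E C k id"
proof -
  obtain a b where C: "C = {a, b}" using assms(2) by (meson card_2_iff)
  have "{m. mixed E C id l m} = {}" for l
    using assms(1) unfolding mixed_def C symp_def by auto
  then have "card {m. mixed E C id l m} \<le> k" for l by simp
  moreover have "contractible E C k (id(a := b) \<circ> id)"
    by (rule contractible.const) (simp add: C)
  ultimately show ?thesis by (rule contractible_step)
qed

text \<open>The vertices in \<open>H\<close> are uncontracted. Each other vertex \<open>u\<close> belongs to the pendant part of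
  \<open>p u\<close>, the only vertex outside of this part to which it may be adjacent.\<close>

locale pendant_state =
  fixes E :: "'a \<Rightarrow> 'a \<Rightarrow> bool" and V H :: "'a set" and p :: "'a \<Rightarrow> 'a"
  assumes finite_V: "finite V" and H_subset: "H \<subseteq> V"
    and p_in: "u \<in> V \<Longrightarrow> p u \<in> H" and p_id: "h \<in> H \<Longrightarrow> p h = h"
    and edge: "u \<in> V \<Longrightarrow> w \<in> V \<Longrightarrow> E u w \<Longrightarrow> p u = p w \<or> u \<in> H \<and> w \<in> H"

locale leaf_piece = pendant_state +
  fixes C :: "'a set" and r :: 'a
  assumes symp_E: "symp E" and C_subset: "C \<subseteq> H" and r_in: "r \<in> C"
    and separated: "u \<in> C - {r} \<Longrightarrow> w \<in> H - C \<Longrightarrow> \<not> E u w"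
begin

text \<open>Here \<open>q\<close> labels the parts of \<open>C\<close>, and \<open>s\<close> labels the pendant parts below \<open>C\<close>, which are ahead of
  \<open>q\<close> by one merge in the intermediate states. The Boolean component tells uncontracted vertices and
  parts of \<open>C\<close> from pendant parts, and \<open>r\<close> always keeps a label of its own.\<close>

definition piece_labels :: "('a \<Rightarrow> 'l) \<Rightarrow> ('a \<Rightarrow> 'l) \<Rightarrow> 'a \<Rightarrow> ('a + 'l) \<times> bool" where
  "piece_labels s q u =
     (if p u \<in> C - {r} then Inr (if u \<in> H then q (p u) else s (p u)) else Inl (p u), u \<in> H)"

text \<open>The constructor and the Boolean distinguish four kinds of classes; the width bound
  treats them one by one. Outer uncontracted vertices form singletons.\<close>

lemma label_outer: "u \<in> V \<Longrightarrow> piece_labels s q u = (Inl h, True) \<longleftrightarrow> u = h \<and> h \<in> H - (C - {r})"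
  using p_id C_subset H_subset by (auto simp: piece_labels_def split: if_splits)

lemma label_inner:
  "u \<in> V \<Longrightarrow> piece_labels s q u = (Inr c, True) \<longleftrightarrow> u \<in> C - {r} \<and> q u = c"
  using p_id C_subset by (auto simp: piece_labels_def split: if_splits)

lemma label_outer_pendant:
  "u \<in> V \<Longrightarrow> piece_labels s q u = (Inl h, False) \<longleftrightarrow> u \<notin> H \<and> p u = h \<and> h \<notin> C - {r}"
  by (auto simp: piece_labels_def split: if_splits)

lemma label_inner_pendant:
  "u \<in> V \<Longrightarrow> piece_labels s q u = (Inr c, False) \<longleftrightarrow> u \<notin> H \<and> p u \<in> C - {r} \<and> s (p u) = c"
  by (auto simp: piece_labels_def split: if_splits)

lemma crossing_edge:
  assumes "u \<in> C - {r}" "w \<in> H" "E u w \<or> E w u"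
  shows "w \<in> C"
  using assms separated[of u w] symp_E unfolding symp_def by blast

text \<open>A mixed pair needs an edge, and edges leaving a pendant class end in the class of the
  vertex it hangs on. So an outer pendant class has at most one mixed partner, and one below
  \<open>C\<close> at most the two parts counted by \<open>fibre\<close>; \<open>\<sigma>\<close> is
  the identity or a single merge. A part of \<open>C\<close> gains only its pendant class and
  \<open>r\<close>, and \<open>r\<close> gains only its pendant class and the rest of the part it
  was taken from.\<close>

lemma piece_labels_width:
  assumes width: "\<And>l. card {m. mixed E C q l m} \<le> k"
    and fibre: "\<And>d. \<exists>a b. \<forall>c. \<sigma> c = d \<longrightarrow> c \<in> {a, b}"
  shows "card {m. mixed E V (piece_labels (\<sigma> \<circ> q) q) l m} \<le> k + 2"
proof -
  let ?F = "piece_labels (\<sigma> \<circ> q) q"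
  have fin_C: "finite C" using finite_V H_subset C_subset by (meson finite_subset)
  have H_V: "u \<in> V" if "u \<in> H" for u using that H_subset by blast
  obtain y t where l: "l = (y, t)" by fastforce
  consider (op) h where "l = (Inl h, False)" | (ip) d where "l = (Inr d, False)"
    | (o) h where "l = (Inl h, True)" | (i) c where "l = (Inr c, True)"
    unfolding l by (cases y; cases t) auto
  then show ?thesis
  proof cases
    case op
    \<comment> \<open>One candidate, written twice to fit \<open>card_le_pair\<close>.\<close>
    have "{m. mixed E V ?F l m} \<subseteq> {(Inl h, True), (Inl h, True)}"
    proof
      fix m assume "m \<in> {m. mixed E V ?F l m}"
      then have "mixed E V ?F l m" by simp
      then obtain u w where uw: "u \<in> V" "w \<in> V" "?F u = l" "?F w = m" "E u w" "l \<noteq> m"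
        by (rule mixedE)
      have u: "u \<notin> H" "p u = h" "h \<notin> C - {r}"
        using uw(3)[unfolded op label_outer_pendant[OF uw(1)]] by simp_all
      have pw: "p w = h" using edge[OF uw(1,2,5)] u by simp
      then have "?F w = (Inl h, w \<in> H)" using u(3) by (simp add: piece_labels_def)
      then show "m \<in> {(Inl h, True), (Inl h, True)}" using uw(4,6) op by (cases "w \<in> H") auto
    qed
    then show ?thesis by (rule card_le_pair)
  next
    case ip
    obtain a b where ab: "\<forall>c. \<sigma> c = d \<longrightarrow> c \<in> {a, b}" using fibre by blast
    have "{m. mixed E V ?F l m} \<subseteq> {(Inr a, True), (Inr b, True)}"
    proof
      fix m assume "m \<in> {m. mixed E V ?F l m}"
      then have "mixed E V ?F l m" by simp
      then obtain u w where uw: "u \<in> V" "w \<in> V" "?F u = l" "?F w = m" "E u w" "l \<noteq> m"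
        by (rule mixedE)
      have u: "u \<notin> H" "p u \<in> C - {r}" "\<sigma> (q (p u)) = d"
        using uw(3)[unfolded ip label_inner_pendant[OF uw(1)]] by simp_all
      have pw: "p w = p u" using edge[OF uw(1,2,5)] u(1) by auto
      then have "?F w = (Inr (if w \<in> H then q (p u) else d), w \<in> H)"
        using u(2,3) by (simp add: piece_labels_def)
      moreover have "q (p u) \<in> {a, b}" using ab u(3) by blast
      ultimately show "m \<in> {(Inr a, True), (Inr b, True)}"
        using uw(4,6) ip by (cases "w \<in> H") auto
    qed
    then show ?thesis by (rule card_le_pair)
  next
    case o
    have "{m. mixed E V ?F l m} \<subseteq> insert (Inl h, False) (insert (Inr (q h), True)
        ((\<lambda>d. (Inr d, True)) ` {d. mixed E C q (q h) d}))"
    proof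
      fix m assume "m \<in> {m. mixed E V ?F l m}"
      then have "mixed E V ?F l m" by simp
      then obtain u w u' w' where uw: "u \<in> V" "w \<in> V" "?F u = l" "?F w = m" "E u w"
        "u' \<in> V" "w' \<in> V" "?F u' = l" "?F w' = m" "\<not> E u' w'" "l \<noteq> m"
        by (rule mixedE)
      have u: "u = h" "u' = h" "h \<in> H" "h \<notin> C - {r}"
        using uw(3)[unfolded o label_outer[OF uw(1)]] uw(8)[unfolded o label_outer[OF uw(6)]]
        by simp_all
      show "m \<in> insert (Inl h, False) (insert (Inr (q h), True)
        ((\<lambda>d. (Inr d, True)) ` {d. mixed E C q (q h) d}))"
      proof (cases "w \<in> H")
        case False
        then have "p w = h" using edge[OF uw(1,2,5)] u p_id[of h] by simp
        then have "?F w = (Inl h, False)" using False u(4) by (simp add: piece_labels_def)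
        then show ?thesis using uw(4) by simp
      next
        case True
        show ?thesis
        proof (cases "w \<in> C - {r}")
          case True
          have "?F w = (Inr (q w), True)" unfolding label_inner[OF uw(2)] using True by simp
          then have m: "m = (Inr (q w), True)" using uw(4) by simp
          have "h \<in> C" using crossing_edge[OF True u(3)] uw(5) u(1) by simp
          have w': "w' \<in> C" "q w' = q w" using uw(9)[unfolded m label_inner[OF uw(7)]] by simp_all
          \<comment> \<open>Here \<open>h\<close> is \<open>r\<close>. The exception
            \<open>q w = q h\<close> is the remainder of the part of \<open>r\<close>, one of the
            two extra neighbours.\<close>
          have "mixed E C q (q h) (q w)" if "q w \<noteq> q h"
            using \<open>h \<in> C\<close> True w' uw(5,10) u(1,2) that
            by (intro mixedI[of h C w E h w']) auto
          then show ?thesis using m by (cases "q w = q h") auto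
        next
          case False
          \<comment> \<open>Two singleton classes are never mixed, so this case is
            contradictory.\<close>
          then have "?F w = (Inl w, True)" unfolding label_outer[OF uw(2)] using True by simp
          then have "?F w' = (Inl w, True)" using uw(4,9) by simp
          then have "w' = w" unfolding label_outer[OF uw(7)] by simp
          then show ?thesis using u(1,2) uw(5,10) by simp
        qed
      qed
    qed
    then show ?thesis by (rule card_le_insert2[OF _ finite_mixed[OF fin_C] width])
  next
    case i
    have "{m. mixed E V ?F l m} \<subseteq> insert (Inr (\<sigma> c), False) (insert (Inl r, True)
        ((\<lambda>d. (Inr d, True)) ` {d. mixed E C q c d}))"
    proof
      fix m assume "m \<in> {m. mixed E V ?F l m}"
      then have "mixed E V ?F l m" by simp
      then obtain u w u' w' where uw: "u \<in> V" "w \<in> V" "?F u = l" "?F w = m" "E u w"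
        "u' \<in> V" "w' \<in> V" "?F u' = l" "?F w' = m" "\<not> E u' w'" "l \<noteq> m"
        by (rule mixedE)
      have u: "u \<in> C - {r}" "q u = c" "u' \<in> C - {r}" "q u' = c"
        using uw(3)[unfolded i label_inner[OF uw(1)]] uw(8)[unfolded i label_inner[OF uw(6)]]
        by simp_all
      have pu: "p u = u" using u(1) C_subset p_id by blast
      show "m \<in> insert (Inr (\<sigma> c), False) (insert (Inl r, True)
        ((\<lambda>d. (Inr d, True)) ` {d. mixed E C q c d}))"
      proof (cases "w \<in> H")
        case False
        then have "p w = u" using edge[OF uw(1,2,5)] pu by auto
        then have "?F w = (Inr (\<sigma> c), False)" using False u(1,2) by (simp add: piece_labels_def)
        then show ?thesis using uw(4) by simp
      next
        case True
        then have "w \<in> C" using crossing_edge[OF u(1)] uw(5) by blast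
        show ?thesis
        proof (cases "w = r")
          case True
          then have "?F w = (Inl r, True)" unfolding label_outer[OF uw(2)] using \<open>w \<in> H\<close> by simp
          then show ?thesis using uw(4) by simp
        next
          case False
          then have "?F w = (Inr (q w), True)" unfolding label_inner[OF uw(2)] using \<open>w \<in> C\<close> by simp
          then have m: "m = (Inr (q w), True)" using uw(4) by simp
          have w': "w' \<in> C" "q w' = q w" using uw(9)[unfolded m label_inner[OF uw(7)]] by simp_all
          have "c \<noteq> q w" using uw(11) i m by simp
          then have "mixed E C q c (q w)"
            using \<open>w \<in> C\<close> w' uw(5,10) u by (intro mixedI[of u C w E u' w']) auto
          then show ?thesis using m by blast
        qed
      qed
    qed
    then show ?thesis by (rule card_le_insert2[OF _ finite_mixed[OF fin_C] width])
  qed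
qed

text \<open>The state after the stage, in the form \<open>(p u, u \<in> H)\<close> for the smaller
  set \<open>H - (C - {r})\<close>, so that an induction on \<open>H\<close> can continue from
  it.\<close>

definition absorbed_labels :: "'a \<Rightarrow> 'a \<times> bool" where
  "absorbed_labels u = (if p u \<in> C then r else p u, u \<in> H - (C - {r}))"

text \<open>Once \<open>C - {r}\<close> is a single class, two merges remain: the pendant class
  below it joins it, and the result joins the pendant class of \<open>r\<close>.\<close>

lemma contractible_constant_piece:
  assumes const: "\<And>u. u \<in> C \<Longrightarrow> q u = c"
    and absorbed: "contractible E V (k + 2) absorbed_labels"
  shows "contractible E V (k + 2) (piece_labels q q)"
proof (rule contractible_step)
  have "{m. mixed E C q l m} = {}" for l using const by (auto simp: mixed_def)
  then have "card {m. mixed E C q l m} \<le> k" for l by simp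
  then show "card {m. mixed E V (piece_labels q q) l m} \<le> k + 2" for l
    using piece_labels_width[of q k id] by simp
  define f where "f u = (if p u \<in> C - {r} then (Inr c, True) else (Inl (p u), u \<in> H))" for u
  have f_eq: "id((Inr c, False) := (Inr c, True)) \<circ> piece_labels q q = f"
    using const by (intro ext) (auto simp: f_def piece_labels_def)
  have "contractible E V (k + 2) f"
  proof (rule contractible_step)
    show "card {m. mixed E V f l m} \<le> k + 2" for l
    proof -
      \<comment> \<open>Between the two merges, an outer vertex can be mixed only with its pendant
        class and the collapsed piece, a pendant class only with its vertex, and the collapsed piece
        only with \<open>r\<close>.\<close>
      have sub: "{m. mixed E V f l m} \<subseteq>
          (case l of (Inl h, True) \<Rightarrow> {(Inl h, False), (Inr c, True)}
           | (Inl h, False) \<Rightarrow> {(Inl h, True), (Inl h, True)} | _ \<Rightarrow> {(Inl r, True), (Inl r, True)})"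
        (is "_ \<subseteq> ?R")
      proof
        fix m assume "m \<in> {m. mixed E V f l m}"
        then have "mixed E V f l m" by simp
        then obtain u w u' w' where uw: "u \<in> V" "w \<in> V" "f u = l" "f w = m" "E u w"
          "u' \<in> V" "w' \<in> V" "f u' = l" "f w' = m" "\<not> E u' w'" "l \<noteq> m"
          by (rule mixedE)
        show "m \<in> ?R"
        proof (cases "p u = p w")
          case True
          then show ?thesis using uw(3,4,11)
            by (cases "u \<in> H"; cases "w \<in> H"; cases "p w \<in> C - {r}") (auto simp: f_def)
        next
          case False
          then have H: "u \<in> H" "w \<in> H" using edge[OF uw(1,2,5)] by blast+
          then have p: "p u = u" "p w = w" by (simp_all add: p_id)
          consider "u \<in> C - {r}" | "u \<notin> C - {r}" "w \<in> C - {r}" | "u \<notin> C - {r}" "w \<notin> C - {r}"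
            by blast
          then show ?thesis
          proof cases
            case 1
            then have "w \<in> C" using crossing_edge[OF _ H(2)] uw(5) by blast
            then have "w = r" using 1 uw(3,4,11) p by (auto simp: f_def split: if_splits)
            then have "m = (Inl r, True)" using uw(4) p H by (simp add: f_def)
            moreover have "l = (Inr c, True)" using uw(3) 1 p by (simp add: f_def)
            ultimately show ?thesis by simp
          next
            case 2
            then have "l = (Inl u, True)" "m = (Inr c, True)" using uw(3,4) p H by (auto simp: f_def)
            then show ?thesis by simp
          next
            case 3
            then have lm: "l = (Inl u, True)" "m = (Inl w, True)" using uw(3,4) p H by (auto simp: f_def)
            then have "u' \<in> H" "p u' = u" "w' \<in> H" "p w' = w"
              using uw(8,9) by (auto simp: f_def split: if_splits)
            then have "u' = u" "w' = w" using p_id by auto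
            then show ?thesis using uw(5,10) by blast
          qed
        qed
      qed
      obtain y t where l: "l = (y, t)" by fastforce
      have "\<exists>a b. ?R = {a, b}"
        unfolding l by (cases y; cases t) (simp_all only: prod.case sum.case bool.case, blast+)
      then show ?thesis using sub card_le_pair by metis
    qed
    show "contractible E V (k + 2) (id((Inr c, True) := (Inl r, False)) \<circ> f)"
    proof (rule contractible_same_kernel[OF absorbed finite_V])
      have eq: "(id((Inr c, True) := (Inl r, False)) \<circ> f) u = map_prod Inl id (absorbed_labels u)"
        if "u \<in> V" for u
        using p_id[of u] r_in by (auto simp: f_def absorbed_labels_def)
      show "absorbed_labels u = absorbed_labels v \<longleftrightarrow>
          (id((Inr c, True) := (Inl r, False)) \<circ> f) u = (id((Inr c, True) := (Inl r, False)) \<circ> f) v"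
        if "u \<in> V" "v \<in> V" for u v
        unfolding eq[OF that(1)] eq[OF that(2)] by (cases "absorbed_labels u"; cases "absorbed_labels v") simp
    qed
  qed
  then show "contractible E V (k + 2) (id((Inr c, False) := (Inr c, True)) \<circ> piece_labels q q)"
    unfolding f_eq .
qed

text \<open>Each merge of parts is imitated by two: first the pendant classes below the parts, then
  the parts themselves. In this order a part never sees more than one pendant class; the opposite
  order could give the merged part two of them besides \<open>r\<close>.\<close>

lemma contractible_piece:
  assumes "contractible E C k q" and absorbed: "contractible E V (k + 2) absorbed_labels"
  shows "contractible E V (k + 2) (piece_labels q q)"
  using assms(1)
proof induction
  case (const q)
  then have "q u = q r" if "u \<in> C" for u using that r_in by blast
  then show ?case by (rule contractible_constant_piece[OF _ absorbed])
next
  case (merge q a b)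
  let ?\<mu> = "id(a := b)"
  have width: "card {m. mixed E C q l m} \<le> k" for l using merge.hyps(1) by blast
  have pendants: "id((Inr a, False) := (Inr b, False)) \<circ> piece_labels q q = piece_labels (?\<mu> \<circ> q) q"
    by (intro ext) (auto simp: piece_labels_def)
  have parts: "id((Inr a, True) := (Inr b, True)) \<circ> piece_labels (?\<mu> \<circ> q) q = piece_labels (?\<mu> \<circ> q) (?\<mu> \<circ> q)"
    by (intro ext) (auto simp: piece_labels_def)
  show ?case
  proof (rule contractible_step)
    show "card {m. mixed E V (piece_labels q q) l m} \<le> k + 2" for l
      using piece_labels_width[OF width, of id l] by simp
    have "contractible E V (k + 2) (piece_labels (?\<mu> \<circ> q) q)"
    proof (rule contractible_step)
      have "\<exists>x y. \<forall>c. ?\<mu> c = d \<longrightarrow> c \<in> {x, y}" for d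
        \<comment> \<open>A label sent to \<open>d\<close> is \<open>d\<close> itself or
          \<open>a\<close>.\<close>
        by (rule exI[of _ a], rule exI[of _ d]) simp
      then show "card {m. mixed E V (piece_labels (?\<mu> \<circ> q) q) l m} \<le> k + 2" for l
        by (rule piece_labels_width[OF width])
      show "contractible E V (k + 2) (id((Inr a, True) := (Inr b, True)) \<circ> piece_labels (?\<mu> \<circ> q) q)"
        unfolding parts by (rule merge.IH)
    qed
    then show "contractible E V (k + 2) (id((Inr a, False) := (Inr b, False)) \<circ> piece_labels q q)"
      unfolding pendants .
  qed
qed

end

subsection \<open>Existence of leaf pieces\<close>

text \<open>Connectedness through cuts instead of paths. The empty set and singletons are linked
  vacuously, so single vertices count as \<open>two_linked\<close>.\<close>

definition linked :: "('a \<Rightarrow> 'a \<Rightarrow> bool) \<Rightarrow> 'a set \<Rightarrow> bool" where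
  "linked E W \<longleftrightarrow> (\<forall>S. S \<subseteq> W \<and> S \<noteq> {} \<and> S \<noteq> W \<longrightarrow> (\<exists>u\<in>S. \<exists>w\<in>W - S. E u w))"

lemma linked_mono:
  assumes "linked E W" "\<And>u w. u \<in> W \<Longrightarrow> w \<in> W \<Longrightarrow> E u w \<Longrightarrow> E' u w"
  shows "linked E' W"
  unfolding linked_def
proof (intro allI impI)
  fix S assume S: "S \<subseteq> W \<and> S \<noteq> {} \<and> S \<noteq> W"
  then obtain u w where uw: "u \<in> S" "w \<in> W - S" "E u w" using assms(1) unfolding linked_def by blast
  then have "E' u w" using assms(2)[of u w] S by blast
  then show "\<exists>u\<in>S. \<exists>w\<in>W - S. E' u w" using uw by blast
qed

definition two_linked :: "('a \<Rightarrow> 'a \<Rightarrow> bool) \<Rightarrow> 'a set \<Rightarrow> bool" where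
  "two_linked E C \<longleftrightarrow> C \<noteq> {} \<and> linked E C \<and> (\<forall>v\<in>C. linked E (C - {v}))"

lemma two_linked_mono:
  assumes "two_linked E C" "\<And>u w. E u w \<Longrightarrow> E' u w"
  shows "two_linked E' C"
  using assms linked_mono[of E _ E'] by (simp add: two_linked_def)

text \<open>With three vertices, one side of any cut has at least two. Deleting one of these keeps
  both sides nonempty, and the edge across the remaining cut crosses the given one.\<close>

lemma linked_if_linked_delete:
  assumes "symp E" "card C \<ge> 3" "\<And>v. v \<in> C \<Longrightarrow> linked E (C - {v})"
  shows "linked E C"
  unfolding linked_def
proof (intro allI impI)
  fix S assume S: "S \<subseteq> C \<and> S \<noteq> {} \<and> S \<noteq> C"
  have fin: "finite C" using assms(2) card.infinite by fastforce
  have card: "card S + card (C - S) = card C"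
    using S fin by (metis card_Diff_subset card_mono finite_subset le_add_diff_inverse)
  have "\<exists>x\<in>C. S - {x} \<noteq> {} \<and> C - {x} - S \<noteq> {}"
  proof (cases "card S \<ge> 2")
    case True
    then obtain x where x: "x \<in> S" by fastforce
    have "card (S - {x}) = card S - 1" using x by simp
    then have "card (S - {x}) \<noteq> 0" using True by linarith
    then have "S - {x} \<noteq> {}" by force
    moreover have "C - {x} - S \<noteq> {}" using S x by blast
    ultimately show ?thesis using x S by blast
  next
    case False
    then have two: "card (C - S) \<ge> 2" using card assms(2) by linarith
    then obtain x where x: "x \<in> C - S" using S by blast
    have "card (C - S - {x}) = card (C - S) - 1" using x by simp
    then have "card (C - S - {x}) \<noteq> 0" using two by linarith
    then have "C - S - {x} \<noteq> {}" by force
    moreover have "S - {x} \<noteq> {}" using S x by blast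
    ultimately show ?thesis using x by blast
  qed
  then obtain x where x: "x \<in> C" "S - {x} \<noteq> {}" "C - {x} - S \<noteq> {}" by blast
  have "S - {x} \<subseteq> C - {x} \<and> S - {x} \<noteq> {} \<and> S - {x} \<noteq> C - {x}" using S x by blast
  then obtain u w where "u \<in> S - {x}" "w \<in> C - {x} - (S - {x})" "E u w"
    using assms(3)[OF x(1)] unfolding linked_def by meson
  then show "\<exists>u\<in>S. \<exists>w\<in>C - S. E u w" by blast
qed

text \<open>\<open>H\<close> itself is a piece, so one of least size exists. If deleting
  \<open>x\<close> splits it, the side avoiding \<open>r\<close> together with \<open>x\<close> is a
  smaller piece attached at \<open>x\<close>.\<close>

lemma ex_leaf_piece:
  assumes "symp E" "finite H" "card H \<ge> 2"
  obtains C r where "C \<subseteq> H" "r \<in> C" "card C \<ge> 2" "\<And>u w. u \<in> C - {r} \<Longrightarrow> w \<in> H - C \<Longrightarrow> \<not> E u w"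
    "card C = 2 \<or> two_linked E C"
proof -
  define piece where "piece C r \<longleftrightarrow>
    C \<subseteq> H \<and> r \<in> C \<and> card C \<ge> 2 \<and> (\<forall>u\<in>C - {r}. \<forall>w\<in>H - C. \<not> E u w)" for C r
  obtain r where "r \<in> H" using assms(3) by fastforce
  then have "\<exists>r. piece H r" using assms(3) unfolding piece_def by blast
  then obtain C where C: "\<exists>r. piece C r" and least: "\<And>D. \<exists>r. piece D r \<Longrightarrow> card C \<le> card D"
    using ex_has_least_nat[of "\<lambda>C. \<exists>r. piece C r" H card] by blast
  then obtain r where r: "C \<subseteq> H" "r \<in> C" "card C \<ge> 2" "\<forall>u\<in>C - {r}. \<forall>w\<in>H - C. \<not> E u w"
    unfolding piece_def by blast
  have fin: "finite C" using finite_subset[OF r(1) assms(2)] .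
  have smaller: False
    if S: "S \<subseteq> C - {x}" "S \<noteq> {}" "S \<noteq> C - {x}" "\<forall>u\<in>S. \<forall>w\<in>C - {x} - S. \<not> E u w"
      and x: "x \<in> C" "r \<notin> S" for S x
  proof -
    have finS: "finite S" using S(1) fin finite_subset by blast
    have "x \<notin> S" using S(1) by blast
    have "card S > 0" using S(2) finS by (simp add: card_gt_0_iff)
    then have two: "card (insert x S) \<ge> 2" using \<open>x \<notin> S\<close> finS by simp
    have cross: "\<not> E u w" if u: "u \<in> insert x S - {x}" and w: "w \<in> H - insert x S" for u w
    proof (cases "w \<in> C")
      case True
      then show ?thesis using S(4) u w by blast
    next
      case False
      moreover have "u \<in> C - {r}" using u S(1) x(2) by blast
      ultimately show ?thesis using r(4) w by blast
    qed
    have "insert x S \<subseteq> H" using S(1) x(1) r(1) by blast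
    then have "piece (insert x S) x"
      unfolding piece_def using two cross by (intro conjI ballI insertI1)
    then have "card C \<le> card (insert x S)" using least by blast
    moreover have "insert x S \<subset> C" using S(1,3) x(1) by blast
    ultimately show False using psubset_card_mono[OF fin, of "insert x S"] by linarith
  qed
  have del: "linked E (C - {x})" if x: "x \<in> C" for x
    unfolding linked_def
  proof (intro allI impI)
    fix S assume S: "S \<subseteq> C - {x} \<and> S \<noteq> {} \<and> S \<noteq> C - {x}"
    show "\<exists>u\<in>S. \<exists>w\<in>C - {x} - S. E u w"
    proof (rule ccontr)
      assume no: "\<not> (\<exists>u\<in>S. \<exists>w\<in>C - {x} - S. E u w)"
      show False
      proof (cases "r \<in> S")
        case False
        then show False using smaller[of S x] S no x by blast
      next
        case True
        \<comment> \<open>By symmetry no edge leaves the other side either, and that side avoids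
          \<open>r\<close>.\<close>
        let ?T = "C - {x} - S"
        have "\<forall>u\<in>?T. \<forall>w\<in>C - {x} - ?T. \<not> E u w"
          using no assms(1) unfolding symp_def by blast
        then show False using smaller[of ?T x] S x True by blast
      qed
    qed
  qed
  have "card C = 2 \<or> two_linked E C"
  proof (cases "card C = 2")
    case False
    then have "card C \<ge> 3" using r(3) by linarith
    then show ?thesis
      using linked_if_linked_delete[OF assms(1)] del r(2) unfolding two_linked_def by blast
  qed simp
  then show ?thesis using that[of C r] r by blast
qed

text \<open>Induction on the number of uncontracted vertices: a leaf piece is collapsed into the
  pendant class of \<open>r\<close>, and everything that hung below it now hangs on
  \<open>r\<close>.\<close>

lemma (in pendant_state) contractible_pendant:
  assumes "symp E" and pieces: "\<And>C. C \<subseteq> V \<Longrightarrow> two_linked E C \<Longrightarrow> contractible E C k id"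
  shows "contractible E V (k + 2) (\<lambda>u. (p u, u \<in> H))"
  using pendant_state_axioms
proof (induction "card H" arbitrary: H p rule: less_induct)
  case less
  interpret pendant_state E V H p by (rule less.prems)
  have fin_H: "finite H" using finite_V H_subset finite_subset by blast
  show ?case
  proof (cases "card H \<ge> 2")
    case True
    obtain C r where C: "C \<subseteq> H" "r \<in> C" "card C \<ge> 2"
      "\<And>u w. u \<in> C - {r} \<Longrightarrow> w \<in> H - C \<Longrightarrow> \<not> E u w" "card C = 2 \<or> two_linked E C"
      using ex_leaf_piece[OF assms(1) fin_H True] by metis
    interpret leaf_piece E V H p C r
      by unfold_locales (use assms(1) C in auto)
    have "C \<subseteq> V" using C(1) H_subset by blast
    then have "contractible E C k id"
      using C(5) contractible_pair[OF assms(1)] pieces by blast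
    moreover have "contractible E V (k + 2) absorbed_labels"
      unfolding absorbed_labels_def
    proof (rule less.hyps)
      have "H - (C - {r}) \<subset> H"
      proof -
        have "card (C - {r}) \<noteq> 0" using C(2,3) by simp
        then have "C - {r} \<noteq> {}" by force
        then show ?thesis using C(1) by blast
      qed
      then show "card (H - (C - {r})) < card H" using fin_H psubset_card_mono by blast
      show "pendant_state E V (H - (C - {r})) (\<lambda>u. if p u \<in> C then r else p u)"
      proof
        show "finite V" by (rule finite_V)
        show "H - (C - {r}) \<subseteq> V" using H_subset by blast
        show "(if p u \<in> C then r else p u) \<in> H - (C - {r})" if "u \<in> V" for u
          using p_in[OF that] C(1,2) by auto
        show "(if p h \<in> C then r else p h) = h" if "h \<in> H - (C - {r})" for h
          using p_id[of h] that C(2) by auto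
        show "(if p u \<in> C then r else p u) = (if p w \<in> C then r else p w) \<or>
            u \<in> H - (C - {r}) \<and> w \<in> H - (C - {r})" if uw: "u \<in> V" "w \<in> V" "E u w" for u w
        proof (cases "p u = p w")
          case False
          then have H: "u \<in> H" "w \<in> H" using edge[OF uw] by blast+
          then have p: "p u = u" "p w = w" by (simp_all add: p_id)
          have "u \<in> C - {r} \<Longrightarrow> w \<in> C" "w \<in> C - {r} \<Longrightarrow> u \<in> C"
            using crossing_edge H uw(3) by blast+
          then show ?thesis using H p by auto
        qed simp
      qed
    qed
    ultimately have "contractible E V (k + 2) (piece_labels id id)"
      by (rule contractible_piece)
    \<comment> \<open>With \<open>q = id\<close> every part is one vertex, so this is the present
      state up to names of labels.\<close>
    then show ?thesis
      by (rule contractible_same_kernel[OF _ finite_V]) (auto simp: piece_labels_def)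
  next
    case False
    show ?thesis
    proof (cases "V = {}")
      case True
      then show ?thesis by (intro contractible.const) simp
    next
      case False
      then obtain v where "v \<in> V" by blast
      then have "p v \<in> H" by (rule p_in)
      then have "card H = 1"
        using \<open>\<not> card H \<ge> 2\<close> fin_H by (metis One_nat_def Suc_1 card_0_eq empty_iff le_SucE not_less_eq_eq nat_le_linear le_zero_eq)
      then obtain h where "H = {h}" by (rule card_1_singletonE)
      then have p: "p u = h" if "u \<in> V" for u using p_in[OF that] by simp
      show ?thesis
      proof (rule contractible_step)
        \<comment> \<open>Only \<open>h\<close> and its pendant class are left.\<close>
        have "{m. mixed E V (\<lambda>u. (p u, u \<in> H)) l m} \<subseteq> {(h, True), (h, False)}" for l
          using p by (auto simp: mixed_def)
        then show "card {m. mixed E V (\<lambda>u. (p u, u \<in> H)) l m} \<le> k + 2" for l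
          by (rule card_le_pair)
        show "contractible E V (k + 2) (id((h, True) := (h, False)) \<circ> (\<lambda>u. (p u, u \<in> H)))"
          by (rule contractible.const) (auto simp: p)
      qed
    qed
  qed
qed

text \<open>The start is the state in which every vertex is uncontracted and no pendant class
  exists.\<close>

lemma contractible_if_two_linked_contractible:
  assumes "symp E" "finite V" "\<And>C. C \<subseteq> V \<Longrightarrow> two_linked E C \<Longrightarrow> contractible E C k id"
  shows "contractible E V (k + 2) id"
proof -
  interpret pendant_state E V V id by unfold_locales (use assms(2) in auto)
  show ?thesis
    by (rule contractible_same_kernel[OF contractible_pendant[OF assms(1,3)] assms(2)]) auto
qed

subsection \<open>Biconnected components\<close>

lemma simple_graph_edge:
  assumes "simple_graph G" "e \<in> black_edges G"
  obtains u v where "u \<in> verts G" "v \<in> verts G" "u \<noteq> v" "e = {u, v}"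
proof -
  have "e \<in> all_edges G" using assms(2) by (simp add: all_edges_def)
  then have "\<exists>u v. u \<in> verts G \<and> v \<in> verts G \<and> u \<noteq> v \<and> e = {u, v}"
    using assms(1) by (simp add: simple_graph_def wf_trigraph_def)
  then show ?thesis by (elim exE conjE) (rule that)
qed

lemma finite_verts: "simple_graph G \<Longrightarrow> finite (verts G)"
  by (simp add: simple_graph_def wf_trigraph_def)

lemma black_edges_subset_Pow:
  assumes "simple_graph G"
  shows "black_edges G \<subseteq> Pow (verts G)"
proof
  fix e assume "e \<in> black_edges G"
  with assms obtain u v where "u \<in> verts G" "v \<in> verts G" "e = {u, v}"
    by (rule simple_graph_edge)
  then show "e \<in> Pow (verts G)" by simp
qed

lemma reachable_alt:
  "simple_graph G \<Longrightarrow>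
    reachable G = {(u, v). u \<in> verts G \<and> v \<in> verts G \<and> (u, v) \<in> {(a, b). edge_rel G a b}\<^sup>*}"
  by (simp add: reachable_def all_edges_def edge_rel_def simple_graph_def)

lemma edge_rel_verts: "simple_graph G \<Longrightarrow> edge_rel G u w \<Longrightarrow> u \<in> verts G \<and> w \<in> verts G"
  using black_edges_subset_Pow unfolding edge_rel_def by fastforce

text \<open>The bound \<open>\<le> 1\<close> includes the empty graph, which arises by deleting the
  only vertex.\<close>

lemma card_connected_components_le_1:
  assumes "simple_graph G"
  shows "card (connected_components G) \<le> 1 \<longleftrightarrow> linked (edge_rel G) (verts G)"
proof
  let ?R = "{(a, b). edge_rel G a b}"
  assume card: "card (connected_components G) \<le> 1"
  show "linked (edge_rel G) (verts G)"
    unfolding linked_def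
  proof (intro allI impI)
    fix S assume S: "S \<subseteq> verts G \<and> S \<noteq> {} \<and> S \<noteq> verts G"
    then obtain u v where uv: "u \<in> S" "v \<in> verts G - S" by blast
    have "finite (connected_components G)"
      unfolding connected_components_def quotient_def using finite_verts[OF assms] by simp
    moreover have "reachable G `` {u} \<in> connected_components G" "reachable G `` {v} \<in> connected_components G"
      using uv S by (auto simp: connected_components_def intro!: quotientI)
    ultimately have "reachable G `` {u} = reachable G `` {v}"
      using card card_le_Suc0_iff_eq[of "connected_components G"] by simp
    moreover have "v \<in> reachable G `` {v}" using uv by (simp add: reachable_alt[OF assms])
    ultimately have "(u, v) \<in> ?R\<^sup>*" by (auto simp: reachable_alt[OF assms])
    \<comment> \<open>A path from \<open>u\<close> to a vertex outside \<open>S\<close> must cross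
      out of \<open>S\<close>.\<close>
    then have "v \<in> S \<or> (\<exists>a\<in>S. \<exists>b\<in>verts G - S. edge_rel G a b)"
    proof induction
      case base
      then show ?case using uv by simp
    next
      case (step y z)
      then have "edge_rel G y z" by simp
      then show ?case using step.IH edge_rel_verts[OF assms, of y z] by blast
    qed
    then show "\<exists>u\<in>S. \<exists>w\<in>verts G - S. edge_rel G u w" using uv by blast
  qed
next
  let ?R = "{(a, b). edge_rel G a b}"
  assume linked: "linked (edge_rel G) (verts G)"
  have reach: "(u, v) \<in> ?R\<^sup>*" if uv: "u \<in> verts G" "v \<in> verts G" for u v
  proof -
    \<comment> \<open>No edge leaves the set of vertices reachable from \<open>u\<close>.\<close>
    define S where "S = {v \<in> verts G. (u, v) \<in> ?R\<^sup>*}"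
    have "\<not> (\<exists>a\<in>S. \<exists>b\<in>verts G - S. edge_rel G a b)"
      unfolding S_def by (auto intro: rtrancl_into_rtrancl)
    moreover have "S \<subseteq> verts G" "S \<noteq> {}" using uv by (auto simp: S_def)
    ultimately have "S = verts G" using linked unfolding linked_def by blast
    then show ?thesis using uv unfolding S_def by blast
  qed
  have "connected_components G \<subseteq> {verts G}"
    unfolding connected_components_def
  proof
    fix X assume "X \<in> verts G // reachable G"
    then obtain u where u: "u \<in> verts G" "X = reachable G `` {u}" by (rule quotientE)
    have "reachable G `` {u} = verts G"
      using u(1) reach[OF u(1)] by (auto simp: reachable_alt[OF assms])
    then show "X \<in> {verts G}" using u(2) by simp
  qed
  then show "card (connected_components G) \<le> 1"
    using card_mono[of "{verts G}"] by fastforce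
qed

lemma card_connected_components_0:
  assumes "simple_graph G"
  shows "card (connected_components G) = 0 \<longleftrightarrow> verts G = {}"
proof -
  have "finite (connected_components G)"
    unfolding connected_components_def quotient_def using finite_verts[OF assms] by simp
  then show ?thesis by (auto simp: connected_components_def quotient_def)
qed

section \<open>Induced subgraphs and maximal biconnected subgraphs\<close>

definition induced_subgraph :: "'a trigraph \<Rightarrow> 'a set \<Rightarrow> 'a trigraph" where
  "induced_subgraph G W = \<lparr> verts = W, black_edges = {e \<in> black_edges G. e \<subseteq> W}, red_edges = {} \<rparr>"

lemma subgraph_induced:
  assumes "simple_graph G" "W \<subseteq> verts G"
  shows "subgraph (induced_subgraph G W) G"
proof -
  have "finite W" using assms finite_verts finite_subset by blast
  moreover have "\<exists>u v. u \<in> W \<and> v \<in> W \<and> u \<noteq> v \<and> e = {u, v}" if "e \<in> black_edges G" "e \<subseteq> W" for e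
    using assms(1) that(1)
  proof (rule simple_graph_edge)
    fix u v assume "u \<noteq> v" "e = {u, v}"
    then show ?thesis using that(2) by blast
  qed
  ultimately show ?thesis
    using assms unfolding subgraph_def simple_graph_def wf_trigraph_def all_edges_def induced_subgraph_def
    by simp
qed

lemma linked_induced:
  assumes "X \<subseteq> W"
  shows "linked (edge_rel (induced_subgraph G W)) X \<longleftrightarrow> linked (edge_rel G) X"
proof
  show "linked (edge_rel G) X" if "linked (edge_rel (induced_subgraph G W)) X"
    by (rule linked_mono[OF that]) (simp add: edge_rel_def induced_subgraph_def)
  show "linked (edge_rel (induced_subgraph G W)) X" if "linked (edge_rel G) X"
    by (rule linked_mono[OF that]) (use assms in \<open>auto simp: edge_rel_def induced_subgraph_def\<close>)
qed

text \<open>A connected graph has exactly one component, so a vertex is a cut vertex iff its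
  deletion leaves more than one, that is, an unlinked set.\<close>

lemma biconnected_iff:
  assumes "simple_graph G"
  shows "biconnected G \<longleftrightarrow> two_linked (edge_rel G) (verts G)"
proof -
  have connected: "connected_graph G \<longleftrightarrow> verts G \<noteq> {} \<and> linked (edge_rel G) (verts G)"
    using card_connected_components_le_1[OF assms] card_connected_components_0[OF assms]
    unfolding connected_graph_def by linarith
  have delete: "card (connected_components (delete_vertex G v)) \<le> 1 \<longleftrightarrow>
      linked (edge_rel G) (verts G - {v})" for v
  proof -
    have delete: "delete_vertex G v = induced_subgraph G (verts G - {v})"
      using black_edges_subset_Pow[OF assms] assms
      unfolding delete_vertex_def induced_subgraph_def simple_graph_def by auto
    have "simple_graph (delete_vertex G v)"
      using subgraph_induced[OF assms, of "verts G - {v}"] by (simp add: delete subgraph_def)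
    then have "card (connected_components (delete_vertex G v)) \<le> 1 \<longleftrightarrow>
        linked (edge_rel (delete_vertex G v)) (verts (delete_vertex G v))"
      by (rule card_connected_components_le_1)
    also have "verts (delete_vertex G v) = verts G - {v}" by (simp add: delete_vertex_def)
    also have "linked (edge_rel (delete_vertex G v)) (verts G - {v}) \<longleftrightarrow> linked (edge_rel G) (verts G - {v})"
      unfolding delete by (rule linked_induced) simp
    finally show ?thesis .
  qed
  show ?thesis
  proof (cases "connected_graph G")
    case True
    then have "cut_vertex G v \<longleftrightarrow> v \<in> verts G \<and> \<not> linked (edge_rel G) (verts G - {v})" for v
      using delete[of v] unfolding cut_vertex_def connected_graph_def by linarith
    then show ?thesis using True connected unfolding biconnected_def two_linked_def by blast
  next
    case False
    then show ?thesis using connected unfolding biconnected_def two_linked_def by blast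
  qed
qed

lemma biconnected_induced_iff:
  assumes "simple_graph G" "W \<subseteq> verts G"
  shows "biconnected (induced_subgraph G W) \<longleftrightarrow> two_linked (edge_rel G) W"
proof -
  have simple: "simple_graph (induced_subgraph G W)"
    using subgraph_induced[OF assms] by (simp add: subgraph_def)
  have "two_linked (edge_rel (induced_subgraph G W)) W \<longleftrightarrow> two_linked (edge_rel G) W"
    unfolding two_linked_def by (simp add: linked_induced)
  then show ?thesis using biconnected_iff[OF simple] by (simp add: induced_subgraph_def)
qed

text \<open>Adding all edges of \<open>G\<close> between the vertices of \<open>C\<close> preserves
  \<open>two_linked\<close>, so by maximality they are already present.\<close>

lemma biconnected_component_induced:
  assumes "C \<in> biconnected_components G"
  shows "C = induced_subgraph G (verts C)" "verts C \<subseteq> verts G" "two_linked (edge_rel G) (verts C)"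
proof -
  have C: "subgraph C G" "biconnected C"
    and max: "subgraph H G \<Longrightarrow> biconnected H \<Longrightarrow> subgraph C H \<Longrightarrow> H = C" for H
    using assms by (simp_all add: biconnected_components_def)
  have simple: "simple_graph C" "simple_graph G" using C(1) by (simp_all add: subgraph_def)
  show sub: "verts C \<subseteq> verts G" using C(1) by (simp add: subgraph_def)
  have edges: "edge_rel C u w \<Longrightarrow> edge_rel G u w" for u w
    using C(1) unfolding edge_rel_def subgraph_def by blast
  have "two_linked (edge_rel C) (verts C)" using C(2) biconnected_iff[OF simple(1)] by blast
  then show linked: "two_linked (edge_rel G) (verts C)" by (rule two_linked_mono[OF _ edges])
  let ?H = "induced_subgraph G (verts C)"
  have H: "subgraph ?H G" by (rule subgraph_induced[OF simple(2) sub])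
  have "subgraph C ?H"
    using C(1) H black_edges_subset_Pow[OF simple(1)]
    unfolding subgraph_def induced_subgraph_def by auto
  moreover have "biconnected ?H" using biconnected_induced_iff[OF simple(2) sub] linked by blast
  ultimately have "?H = C" using max[OF H] by blast
  then show "C = ?H" ..
qed

lemma finite_biconnected_components:
  assumes "simple_graph G"
  shows "finite (biconnected_components G)"
proof -
  have "biconnected_components G \<subseteq> induced_subgraph G ` Pow (verts G)"
    using biconnected_component_induced(1,2) by blast
  then show ?thesis using finite_verts[OF assms] finite_subset by blast
qed

text \<open>A largest \<open>two_linked\<close> superset of \<open>W\<close> induces a component: a
  biconnected subgraph above it has the same vertices, and its edges lie between those of the
  induced subgraph and those of \<open>G\<close>.\<close>

lemma ex_biconnected_component:
  assumes "simple_graph G" "W \<subseteq> verts G" "two_linked (edge_rel G) W"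
  obtains C where "C \<in> biconnected_components G" "W \<subseteq> verts C"
proof -
  let ?P = "\<lambda>U. W \<subseteq> U \<and> U \<subseteq> verts G \<and> two_linked (edge_rel G) U"
  have fin: "finite (verts G)" by (rule finite_verts[OF assms(1)])
  have "?P W" using assms by blast
  \<comment> \<open>The maximum principle asks for a strict bound, hence the successor.\<close>
  moreover have "\<forall>U. ?P U \<longrightarrow> card U < Suc (card (verts G))"
    using card_mono[OF fin] by (simp add: less_Suc_eq_le)
  ultimately have "\<exists>U. ?P U \<and> (\<forall>U'. ?P U' \<longrightarrow> card U' \<le> card U)"
    by (rule ex_has_greatest_nat)
  then obtain U where U: "?P U" and max: "\<forall>U'. ?P U' \<longrightarrow> card U' \<le> card U"
    by (elim exE) (erule conjE, rule that)
  let ?C = "induced_subgraph G U"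
  have sub: "subgraph ?C G" using subgraph_induced[OF assms(1)] U by blast
  have "H = ?C" if H: "subgraph H G" "biconnected H" "subgraph ?C H" for H
  proof -
    have simple: "simple_graph H" using H(1) by (simp add: subgraph_def)
    have edges: "edge_rel H u w \<Longrightarrow> edge_rel G u w" for u w
      using H(1) unfolding edge_rel_def subgraph_def by blast
    have "two_linked (edge_rel H) (verts H)" using H(2) biconnected_iff[OF simple] by blast
    then have "two_linked (edge_rel G) (verts H)" by (rule two_linked_mono[OF _ edges])
    moreover have subs: "U \<subseteq> verts H" "verts H \<subseteq> verts G"
      using H(1,3) by (auto simp: subgraph_def induced_subgraph_def)
    ultimately have "card (verts H) \<le> card U" using max U by blast
    then have verts: "verts H = U"
      using subs finite_verts[OF simple] card_seteq by blast
    have "black_edges H = black_edges ?C"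
      using H(1,3) black_edges_subset_Pow[OF simple] verts
      unfolding subgraph_def induced_subgraph_def by auto
    moreover have "red_edges H = {}" using simple by (simp add: simple_graph_def)
    ultimately show ?thesis
      using verts by (intro trigraph.equality) (simp_all add: induced_subgraph_def)
  qed
  then have "?C \<in> biconnected_components G"
    using sub U biconnected_induced_iff[OF assms(1), of U]
    unfolding biconnected_components_def by blast
  then show ?thesis using that U by (simp add: induced_subgraph_def)
qed

lemma tww_biconnected_component_le_iff:
  assumes "simple_graph G" "C \<in> biconnected_components G"
  shows "tww C \<le> k \<longleftrightarrow> contractible (edge_rel G) (verts C) k id"
proof -
  have ind: "C = induced_subgraph G (verts C)" and sub: "verts C \<subseteq> verts G"
    and ne: "verts C \<noteq> {}"
    using biconnected_component_induced[OF assms(2)] by (auto simp: two_linked_def)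
  have simple: "simple_graph C"
    using subgraph_induced[OF assms(1) sub] ind by (simp add: subgraph_def)
  have "black_edges C = {e \<in> black_edges G. e \<subseteq> verts C}"
    by (subst ind) (simp add: induced_subgraph_def)
  then have "\<forall>u\<in>verts C. \<forall>w\<in>verts C. edge_rel C u w \<longleftrightarrow> edge_rel G u w"
    by (simp add: edge_rel_def)
  then show ?thesis
    unfolding tww_le_iff[OF simple ne]
    using contractible_cong_edges[of "edge_rel C" "verts C" k id "edge_rel G"]
      contractible_cong_edges[of "edge_rel G" "verts C" k id "edge_rel C"] by blast
qed

theorem theorem2:
  fixes G :: "'a trigraph"
  assumes "simple_graph G" and "verts G \<noteq> {}"
  shows "Max (tww ` biconnected_components G) \<le> tww G \<and>
         tww G \<le> Max (tww ` biconnected_components G) + 2"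
proof -
  let ?B = "biconnected_components G" and ?E = "edge_rel G"
  have fin: "finite ?B" by (rule finite_biconnected_components[OF assms(1)])
  obtain v where v: "v \<in> verts G" using assms(2) by blast
  \<comment> \<open>A single vertex extends to a component, so the maximum is over a nonempty
    set.\<close>
  have "linked ?E {v}" "linked ?E {}" unfolding linked_def by blast+
  then have "two_linked ?E {v}" by (simp add: two_linked_def)
  then have ne: "?B \<noteq> {}" using ex_biconnected_component[OF assms(1), of "{v}"] v by blast
  have "contractible ?E (verts G) (tww G) id" using tww_le_iff[OF assms] by blast
  then have "tww C \<le> tww G" if "C \<in> ?B" for C
    using contractible_subset[OF _ finite_verts[OF assms(1)]] biconnected_component_induced(2)[OF that]
      tww_biconnected_component_le_iff[OF assms(1) that] by blast
  then have lower: "Max (tww ` ?B) \<le> tww G" using fin ne by simp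
  \<comment> \<open>Every \<open>two_linked\<close> set lies in a component and inherits its bound
    by restriction.\<close>
  have "contractible ?E W (Max (tww ` ?B)) id" if W: "W \<subseteq> verts G" "two_linked ?E W" for W
  proof -
    obtain C where C: "C \<in> ?B" "W \<subseteq> verts C"
      using ex_biconnected_component[OF assms(1) W] by blast
    have "tww C \<le> Max (tww ` ?B)" using fin C(1) by simp
    then have "contractible ?E (verts C) (Max (tww ` ?B)) id"
      using tww_biconnected_component_le_iff[OF assms(1) C(1)] by blast
    moreover have "finite (verts C)"
      using finite_verts[OF assms(1)] biconnected_component_induced(2)[OF C(1)] finite_subset by blast
    ultimately show ?thesis using C(2) by (rule contractible_subset)
  qed
  then have "contractible ?E (verts G) (Max (tww ` ?B) + 2) id"
    by (rule contractible_if_two_linked_contractible[OF symp_edge_rel finite_verts[OF assms(1)]])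
  then have "tww G \<le> Max (tww ` ?B) + 2" using tww_le_iff[OF assms] by blast
  with lower show ?thesis ..
qed

end
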